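(* Let $G$ and $H$ be connected graphs, each with at least two vertices. Let $r$ be the maximum number of vertices of an induced path in $G$ whose vertex set is cycle convex in $G$, and let $s$ be the maximum number of vertices of an induced path in $H$ whose vertex set is cycle convex in $H$. Then $\operatorname{car}(G\,\square\,H)\geq \max\{r+s-1,\ \operatorname{car}(G)+\operatorname{car}(H)-1\}$.
   Context: All graphs are finite, simple and undirected; $F[X]$ denotes the subgraph of $F$ induced by $X$. The Cartesian product $G\,\square\,H$ has vertex set $V(G)\times V(H)$, with $(g_1,h_1)$ adjacent to $(g_2,h_2)$ iff either $g_1g_2\in E(G)$ and $h_1=h_2$, or $g_1=g_2$ and $h_1h_2\in E(H)$. In a graph $F$, a set $S\subseteq V(F)$ is cycle convex if for every $u\in V(F)\setminus S$ the graph $F[S\cup\{u\}]$ contains no cycle passing through $u$; the cycle convex hull $\langle S\rangle$ is the smallest cycle convex set containing $S$; $S$ is Carathéodory independent if there is $p\in\langle S\rangle$ with $p\notin \bigcup_{a\in S}\langle S\setminus\{a\}\rangle$; and $\operatorname{car}(F)$ is the maximum cardinality of a Carathéodory independent set of $F$. *)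

theory Defs
  imports "Graph_Theory.Graph_Theory"
begin

text \<open>
  A finite simple undirected graph is a \<open>pair_graph\<close>: every edge is represented by the two
  opposite arcs between its ends.
\<close>

definition cartesian_product ::
    "'a pair_pre_digraph \<Rightarrow> 'b pair_pre_digraph \<Rightarrow> ('a \<times> 'b) pair_pre_digraph"
    (infixr \<open>\<box>\<close> 75) where
  "G \<box> H = \<lparr> pverts = pverts G \<times> pverts H,
     parcs = {((g1, h1), (g2, h2)) | g1 h1 g2 h2.
       (g1, g2) \<in> parcs G \<and> h1 = h2 \<and> h1 \<in> pverts H \<or>
       g1 = g2 \<and> g1 \<in> pverts G \<and> (h1, h2) \<in> parcs H} \<rparr>"

text \<open>
  The constant \<open>pre_digraph.cycle\<close> also admits the closed walk of length two that traverses a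
  single edge back and forth, which is not a cycle of the undirected graph; hence the length bound.
\<close>

definition cycle_through :: "('a, 'b) pre_digraph \<Rightarrow> 'a \<Rightarrow> bool" where
  "cycle_through F u \<longleftrightarrow>
     (\<exists>c. pre_digraph.cycle F c \<and> 3 \<le> length c \<and> u \<in> tail F ` set c)"

definition cycle_convex :: "'a pair_pre_digraph \<Rightarrow> 'a set \<Rightarrow> bool" where
  "cycle_convex F S \<longleftrightarrow> S \<subseteq> pverts F \<and>
     (\<forall>u \<in> pverts F - S. \<not> cycle_through (with_proj F \<restriction> (S \<union> {u})) u)"

definition cycle_hull :: "'a pair_pre_digraph \<Rightarrow> 'a set \<Rightarrow> 'a set" where
  "cycle_hull F S = cycle_convex F hull S"

definition caratheodory_independent :: "'a pair_pre_digraph \<Rightarrow> 'a set \<Rightarrow> bool" where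
  "caratheodory_independent F S \<longleftrightarrow> S \<subseteq> pverts F \<and>
     (\<exists>p \<in> cycle_hull F S. p \<notin> (\<Union>a\<in>S. cycle_hull F (S - {a})))"

definition car :: "'a pair_pre_digraph \<Rightarrow> nat" where
  "car F = Max {card S | S. caratheodory_independent F S}"

text \<open>
  The path is induced: the only edges inside \<open>X\<close> are those it traverses. For \<open>p = []\<close> this is
  the path with a single vertex.
\<close>

definition induced_path_verts :: "'a pair_pre_digraph \<Rightarrow> 'a set \<Rightarrow> bool" where
  "induced_path_verts F X \<longleftrightarrow>
     (\<exists>u p v. pre_digraph.apath (with_proj F) u p v \<and>
        X = set (pre_digraph.awalk_verts (with_proj F) u p) \<and>
        arcs (with_proj F \<restriction> X) = set p \<union> (set p)\<inverse>)"

definition max_convex_induced_path :: "'a pair_pre_digraph \<Rightarrow> nat" where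
  "max_convex_induced_path F = Max {card X | X. induced_path_verts F X \<and> cycle_convex F X}"


text \<open>The hull is the smallest cycle convex set containing a given set of vertices.\<close>

lemma cycle_through_mono:
  assumes "cycle_through (with_proj F \<restriction> A) u" "A \<subseteq> B"
  shows "cycle_through (with_proj F \<restriction> B) u"
proof -
  have cas: "pre_digraph.cas (with_proj F \<restriction> C) = pcas" for C
  proof (unfold fun_eq_iff, intro allI)
    fix u es v show "pre_digraph.cas (with_proj F \<restriction> C) u es v = pcas u es v"
      by (induct es arbitrary: u) (auto simp: pre_digraph.cas.simps induce_subgraph_def)
  qed
  have aw: "pre_digraph.awalk_verts (with_proj F \<restriction> C) = pawalk_verts" for C
  proof (unfold fun_eq_iff, intro allI)
    fix u es show "pre_digraph.awalk_verts (with_proj F \<restriction> C) u es = pawalk_verts u es"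
      by (induct es arbitrary: u) (auto simp: pre_digraph.awalk_verts.simps induce_subgraph_def)
  qed
  from assms(1) obtain c x where c:
    "x \<in> A" "set c \<subseteq> arcs (with_proj F \<restriction> A)" "pcas x c x"
    "distinct (tl (pawalk_verts x c))" "c \<noteq> []" "3 \<le> length c" "u \<in> fst ` set c"
    unfolding cycle_through_def pre_digraph.cycle_def pre_digraph.awalk_def cas aw
    by (auto simp: induce_subgraph_def)
  moreover have "arcs (with_proj F \<restriction> A) \<subseteq> arcs (with_proj F \<restriction> B)"
    using assms(2) by (auto simp: induce_subgraph_def)
  ultimately have "pre_digraph.cycle (with_proj F \<restriction> B) c"
    using assms(2) unfolding pre_digraph.cycle_def pre_digraph.awalk_def cas aw
    by (intro exI[of _ x]) auto
  with c show ?thesis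
    unfolding cycle_through_def by (intro exI[of _ c]) (simp add: induce_subgraph_def)
qed

lemma cycle_convex_pverts: "cycle_convex F (pverts F)"
  by (simp add: cycle_convex_def)

lemma cycle_convex_cycle_hull:
  assumes "S \<subseteq> pverts F"
  shows "cycle_convex F (cycle_hull F S)"
  unfolding cycle_convex_def
proof (intro conjI ballI)
  show "cycle_hull F S \<subseteq> pverts F"
    unfolding cycle_hull_def by (rule hull_minimal[where S="cycle_convex F", OF assms cycle_convex_pverts])
next
  fix u assume u: "u \<in> pverts F - cycle_hull F S"
  then obtain T where T: "cycle_convex F T" "S \<subseteq> T" "u \<notin> T"
    unfolding cycle_hull_def hull_def by auto
  have sub: "cycle_hull F S \<union> {u} \<subseteq> T \<union> {u}"
    unfolding cycle_hull_def using hull_minimal[where S="cycle_convex F", OF T(2,1)] by auto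
  have "\<not> cycle_through (with_proj F \<restriction> (T \<union> {u})) u"
    using T(1,3) u unfolding cycle_convex_def by simp
  then show "\<not> cycle_through (with_proj F \<restriction> (cycle_hull F S \<union> {u})) u"
    using cycle_through_mono[OF _ sub] by (rule contrapos_nn)
qed

lemma subset_cycle_hull: "S \<subseteq> cycle_hull F S"
  unfolding cycle_hull_def by (rule hull_subset)

lemma cycle_hull_minimal: "S \<subseteq> T \<Longrightarrow> cycle_convex F T \<Longrightarrow> cycle_hull F S \<subseteq> T"
  unfolding cycle_hull_def by (rule hull_minimal)

end

theory Submission
  imports Defs
begin

text \<open>
  A vertex \<open>u\<close> outside \<open>S\<close> violates convexity iff it has two neighbours in one component of \<open>S\<close>.
  Both bounds come from a cross \<open>X \<times> {y0} \<union> {x0} \<times> Y\<close> in the product. When the hulls of \<open>X\<close> and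
  \<open>Y\<close> are connected, closing up squares shows that the hull of the cross is the box
  \<open>\<langle>X\<rangle> \<times> \<langle>Y\<rangle>\<close>. After removing \<open>(a, y0)\<close> with \<open>a \<noteq> x0\<close>, the hull is contained in the convex set
  \<open>C \<times> \<langle>Y\<rangle> \<union> (Z - C) \<times> {y0}\<close>, where \<open>Z = \<langle>X - {a}\<rangle>\<close> and \<open>C\<close> is the component of \<open>x0\<close> in \<open>Z\<close>;
  after removing the centre, it is contained in
  \<open>\<langle>X - {x0}\<rangle> \<times> {y0} \<union> {x0} \<times> \<langle>Y - {y0}\<rangle>\<close>. Hence \<open>(p, q)\<close> witnesses independence both when
  \<open>X\<close> and \<open>Y\<close> are Caratheodory independent with witnesses \<open>p\<close> and \<open>q\<close> and when they are convex
  induced paths from \<open>x0\<close> to \<open>p\<close> and from \<open>y0\<close> to \<open>q\<close>. If \<open>r = 1\<close>, every edge of \<open>G\<close> lies in a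
  triangle, so an edge is an independent set and can be crossed with a path on \<open>s - 1\<close> vertices.
\<close>

section \<open>Cycles and simple walks as lists of arcs\<close>

text \<open>Inducing a subgraph leaves \<open>tail\<close> and \<open>head\<close> unchanged, so
  \<open>cas\<close> and \<open>awalk_verts\<close> agree with those of the full graph, and the
  vertices of a walk after the first are \<open>map snd c\<close>. Cycles thus become plain lists of
  pairs.\<close>

lemma cycle_through_induce_iff:
  "cycle_through (with_proj F \<restriction> C) u \<longleftrightarrow>
     (\<exists>x c. x \<in> C \<and> set c \<subseteq> parcs F \<inter> C \<times> C \<and> pcas x c x \<and> distinct (map snd c)
        \<and> 3 \<le> length c \<and> u \<in> fst ` set c)"
proof -
  have cas: "pre_digraph.cas (with_proj F \<restriction> C) = pcas"
  proof (unfold fun_eq_iff, intro allI)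
    fix u es v show "pre_digraph.cas (with_proj F \<restriction> C) u es v = pcas u es v"
      by (induct es arbitrary: u) (auto simp: pre_digraph.cas.simps induce_subgraph_def)
  qed
  have aw: "pre_digraph.awalk_verts (with_proj F \<restriction> C) = pawalk_verts"
  proof (unfold fun_eq_iff, intro allI)
    fix u es show "pre_digraph.awalk_verts (with_proj F \<restriction> C) u es = pawalk_verts u es"
      by (induct es arbitrary: u) (auto simp: pre_digraph.awalk_verts.simps induce_subgraph_def)
  qed
  have verts: "pawalk_verts x c = x # map snd c" if "pcas x c y" for x y c
    using that by (induct c arbitrary: x) auto
  have arcs: "arcs (with_proj F \<restriction> C) = parcs F \<inter> C \<times> C"
    by (auto simp: induce_subgraph_def)
  have simps: "verts (with_proj F \<restriction> C) = C" "tail (with_proj F \<restriction> C) = fst"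
    by (simp_all add: induce_subgraph_def)
  have "cycle_through (with_proj F \<restriction> C) u \<longleftrightarrow>
     (\<exists>c. (\<exists>x. (x \<in> C \<and> set c \<subseteq> parcs F \<inter> C \<times> C \<and> pcas x c x) \<and>
        distinct (tl (pawalk_verts x c)) \<and> c \<noteq> []) \<and> 3 \<le> length c \<and> u \<in> fst ` set c)"
    unfolding cycle_through_def pre_digraph.cycle_def pre_digraph.awalk_def cas aw arcs simps
    by (rule refl)
  also have "\<dots> \<longleftrightarrow> (\<exists>x c. x \<in> C \<and> set c \<subseteq> parcs F \<inter> C \<times> C \<and> pcas x c x \<and> distinct (map snd c)
        \<and> 3 \<le> length c \<and> u \<in> fst ` set c)" (is "?L \<longleftrightarrow> ?R")
  proof
    assume ?L
    then obtain x c where "x \<in> C" "set c \<subseteq> parcs F \<inter> C \<times> C" "pcas x c x"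
      "distinct (tl (pawalk_verts x c))" "3 \<le> length c" "u \<in> fst ` set c" by blast
    then show ?R using verts[of x c x] by (intro exI[of _ x] exI[of _ c]) simp
  next
    assume ?R
    then obtain x c where "x \<in> C \<and> set c \<subseteq> parcs F \<inter> C \<times> C \<and> pcas x c x \<and> distinct (map snd c)
        \<and> 3 \<le> length c \<and> u \<in> fst ` set c" by blast
    then show ?L using verts[of x c x] by (intro exI[of _ c] conjI exI[of _ x]) auto
  qed
  finally show ?thesis .
qed

lemma pcas_append: "pcas u (p @ q) w \<longleftrightarrow> (\<exists>v. pcas u p v \<and> pcas v q w)"
  by (induct p arbitrary: u) auto

text \<open>Walks are extended at the front; if the new start \<open>x\<close> already occurs, the
  walk is cut to the part after that occurrence. That \<open>x\<close> is never entered again allows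
  the walk to be closed up to a cycle later.\<close>

lemma rtrancl_imp_simple_pcas:
  assumes "(x, y) \<in> R\<^sup>*"
  shows "\<exists>p. pcas x p y \<and> set p \<subseteq> R \<and> distinct (map snd p) \<and> x \<notin> snd ` set p"
  using assms
proof (induct rule: converse_rtrancl_induct)
  case base
  show ?case by (intro exI[of _ "[]"]) auto
next
  case (step x x')
  then obtain p where p: "pcas x' p y" "set p \<subseteq> R" "distinct (map snd p)" "x' \<notin> snd ` set p"
    by blast
  consider "x = x'" | "x \<noteq> x'" "x \<notin> snd ` set p" | "x \<in> snd ` set p" by blast
  then show ?case
  proof cases
    case 1
    then show ?thesis using p by blast
  next
    case 2
    then show ?thesis using p step(1) by (intro exI[of _ "(x, x') # p"]) auto
  next
    case 3
    then obtain e where "e \<in> set p" "snd e = x" by blast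
    then obtain p1 p2 where eq: "p = (p1 @ [e]) @ p2" by (auto dest: split_list)
    have "pcas x p2 y" using p(1) \<open>snd e = x\<close> unfolding eq pcas_append by auto
    moreover have "x \<notin> snd ` set p2" using p(3) \<open>snd e = x\<close> unfolding eq by auto
    ultimately show ?thesis using p unfolding eq by (intro exI[of _ p2]) auto
  qed
qed

section \<open>Connectivity inside a vertex set\<close>

text \<open>The closure is reflexive also at vertices outside \<open>S\<close>, so membership in
  \<open>S\<close> has to be supplied separately.\<close>

definition linked :: "'a pair_pre_digraph \<Rightarrow> 'a set \<Rightarrow> 'a rel" where
  "linked F S = (parcs F \<inter> S \<times> S)\<^sup>*"

lemma linked_refl [simp]: "(x, x) \<in> linked F S"
  by (simp add: linked_def)

lemma linked_trans: "(x, y) \<in> linked F S \<Longrightarrow> (y, z) \<in> linked F S \<Longrightarrow> (x, z) \<in> linked F S"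
  unfolding linked_def by (rule rtrancl_trans)

lemma linked_step: "(x, y) \<in> parcs F \<Longrightarrow> x \<in> S \<Longrightarrow> y \<in> S \<Longrightarrow> (x, y) \<in> linked F S"
  unfolding linked_def by auto

lemma linked_mono: "S \<subseteq> T \<Longrightarrow> (x, y) \<in> linked F S \<Longrightarrow> (x, y) \<in> linked F T"
  unfolding linked_def by (erule rtrancl_mono[THEN subsetD, rotated]) auto

text \<open>A walk inside \<open>S\<close> cannot leave a set closed under the arcs of
  \<open>S\<close>. The set \<open>C\<close> will be a union of components, one arm of a cross, or
  an initial segment of a path.\<close>

lemma linked_closed_subset:
  assumes "(x, y) \<in> linked F S" "x \<in> C"
    and "\<And>a b. a \<in> C \<Longrightarrow> b \<in> S \<Longrightarrow> a \<in> S \<Longrightarrow> (a, b) \<in> parcs F \<Longrightarrow> b \<in> C"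
  shows "(x, y) \<in> linked F (S \<inter> C)" and "y \<in> C"
proof -
  have "(x, y) \<in> linked F (S \<inter> C) \<and> y \<in> C"
    using assms(1) unfolding linked_def
  proof (induct rule: rtrancl_induct)
    case base
    then show ?case using assms(2) by simp
  next
    case (step y z)
    then have "(y, z) \<in> parcs F \<inter> (S \<inter> C) \<times> (S \<inter> C)" using assms(3)[of y z] by blast
    then show ?case using step by (auto intro: rtrancl_into_rtrancl)
  qed
  then show "(x, y) \<in> linked F (S \<inter> C)" "y \<in> C" by auto
qed

lemma linked_in:
  assumes "(x, y) \<in> linked F S" "x \<in> S"
  shows "y \<in> S"
  using linked_closed_subset(2)[OF assms] by blast

text \<open>An arc may be contracted to a vertex, so this covers the projections of a product to its
  factors as well as the embeddings of a factor as a fibre.\<close>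

lemma linked_image:
  assumes "(x, y) \<in> linked F S"
    and "\<And>a b. (a, b) \<in> parcs F \<Longrightarrow> a \<in> S \<Longrightarrow> b \<in> S \<Longrightarrow> (f a, f b) \<in> linked F' S'"
  shows "(f x, f y) \<in> linked F' S'"
  using assms(1) unfolding linked_def[of F]
proof (induct rule: rtrancl_induct)
  case (step y z)
  then show ?case using assms(2)[of y z] by (auto intro: linked_trans)
qed simp

lemma pair_graph_sym: "pair_graph F \<Longrightarrow> (x, y) \<in> parcs F \<Longrightarrow> (y, x) \<in> parcs F"
proof -
  assume "pair_graph F" and xy: "(x, y) \<in> parcs F"
  then interpret pair_graph F by simp
  show ?thesis using pair_sym_arcs xy by (auto simp: symmetric_def elim: symE)
qed

lemma pair_graph_irrefl: "pair_graph F \<Longrightarrow> (x, x) \<notin> parcs F"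
proof -
  assume "pair_graph F"
  then interpret pair_graph F .
  show ?thesis using pair_no_loops[of "(x, x)"] by auto
qed

lemma pair_graph_arcD:
  assumes "pair_graph F" "(x, y) \<in> parcs F"
  shows "x \<in> pverts F" "y \<in> pverts F"
proof -
  interpret pair_graph F by fact
  show "x \<in> pverts F" "y \<in> pverts F" using assms(2) by (auto dest: in_arcsD1 in_arcsD2)
qed

lemma pair_graph_finite: "pair_graph F \<Longrightarrow> finite (pverts F)"
  by (meson pair_digraph.axioms(1) pair_fin_digraph.pair_finite_verts pair_graph.axioms(1))

lemma linked_sym:
  assumes "pair_graph F" "(x, y) \<in> linked F S"
  shows "(y, x) \<in> linked F S"
proof -
  have "sym (parcs F \<inter> S \<times> S)" using pair_graph_sym[OF assms(1)] by (auto simp: sym_def)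
  then show ?thesis using assms(2) unfolding linked_def by (metis sym_rtrancl symD)
qed

section \<open>Cycle convexity in terms of linked neighbours\<close>

text \<open>Deleting \<open>u\<close> from a cycle leaves a walk in \<open>S\<close> between two
  neighbours of \<open>u\<close>; conversely, a simple walk in \<open>S\<close> between two distinct
  neighbours closes up through \<open>u\<close>. The condition \<open>x \<noteq> y\<close>
  corresponds to the length bound 3.\<close>

lemma cycle_through_insert_iff:
  assumes "pair_graph F" "u \<notin> S"
  shows "cycle_through (with_proj F \<restriction> (S \<union> {u})) u \<longleftrightarrow>
    (\<exists>x\<in>S. \<exists>y\<in>S. x \<noteq> y \<and> (u, x) \<in> parcs F \<and> (u, y) \<in> parcs F \<and> (x, y) \<in> linked F S)"
    (is "?L \<longleftrightarrow> ?R")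
proof
  assume ?L
  then obtain z c where c: "set c \<subseteq> parcs F \<inter> (S \<union> {u}) \<times> (S \<union> {u})" "pcas z c z"
    "distinct (map snd c)" "3 \<le> length c" "u \<in> fst ` set c"
    unfolding cycle_through_induce_iff by blast
  from c(5) obtain e where "e \<in> set c" and e: "fst e = u" by blast
  then obtain c1 c2 where cs: "c = c1 @ e # c2" by (meson split_list)
  \<comment> \<open>The cycle is rotated so that the arc \<open>e\<close> leaving \<open>u\<close>
    comes first; the remainder \<open>d\<close> then ends with an arc \<open>f\<close> back into
    \<open>u\<close>.\<close>
  define d where "d = c2 @ c1"
  have d: "pcas (snd e) d u" "set d \<subseteq> parcs F \<inter> (S \<union> {u}) \<times> (S \<union> {u})"
    "distinct (map snd (e # d))" "2 \<le> length d"
    using c e unfolding cs d_def by (auto simp: pcas_append)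
  from d(4) have "d \<noteq> []" by auto
  then obtain d' f where df: "d = d' @ [f]" by (meson rev_exhaust)
  have f: "snd f = u" and d': "pcas (snd e) d' (fst f)" using d(1) unfolding df pcas_append by auto
  have nu: "u \<notin> snd ` set d'" "snd e \<noteq> u" using d(3) f unfolding df by auto
  have eS: "snd e \<in> S" using c(1) nu(2) unfolding cs by (cases e) auto
  have walk: "(x, y) \<in> linked F S" if "pcas x p y" "x \<in> S"
    "set p \<subseteq> parcs F \<inter> (S \<union> {u}) \<times> (S \<union> {u})" "u \<notin> snd ` set p" for x y p
    using that
  proof (induct p arbitrary: x)
    case (Cons g p)
    obtain a b where g: "g = (a, b)" by fastforce
    have "b \<in> S" "(x, b) \<in> linked F S" using Cons.prems unfolding g by (auto intro: linked_step)
    then show ?case using Cons unfolding g by (auto intro: linked_trans)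
  qed simp
  have l: "(snd e, fst f) \<in> linked F S" using walk[OF d' eS] d(2) nu unfolding df by auto
  \<comment> \<open>Length at least 3 leaves an arc \<open>g\<close> between \<open>e\<close> and
    \<open>f\<close>, so the heads of \<open>e\<close> and \<open>g\<close> are distinct; these are
    the two neighbours of \<open>u\<close>.\<close>
  have "d' \<noteq> []" using d(4) unfolding df by auto
  then obtain d'' g where dg: "d' = d'' @ [g]" by (meson rev_exhaust)
  have "snd g = fst f" using d' unfolding dg pcas_append by auto
  then have ne: "snd e \<noteq> fst f" using d(3) unfolding df dg by auto
  have fS: "fst f \<in> S" using linked_in[OF l eS] .
  have "(u, snd e) \<in> parcs F" using c(1) e unfolding cs by (cases e) auto
  moreover have "(fst f, u) \<in> parcs F" using d(2) f unfolding df by (cases f) auto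
  ultimately show ?R using l ne fS eS pair_graph_sym[OF assms(1)] by blast
next
  assume ?R
  then obtain x y where xy: "x \<in> S" "y \<in> S" "x \<noteq> y" "(u, x) \<in> parcs F" "(u, y) \<in> parcs F"
    "(x, y) \<in> linked F S" by blast
  obtain p where p: "pcas x p y" "set p \<subseteq> parcs F \<inter> S \<times> S" "distinct (map snd p)"
    "x \<notin> snd ` set p"
    using rtrancl_imp_simple_pcas xy(6) unfolding linked_def by metis
  have "p \<noteq> []" using p(1) xy(3) by auto
  have "u \<notin> snd ` set p" using p(2) assms(2) by fastforce
  define c where "c = (u, x) # p @ [(y, u)]"
  have yu: "(y, u) \<in> parcs F" using pair_graph_sym[OF assms(1) xy(5)] .
  have "set c \<subseteq> parcs F \<inter> (S \<union> {u}) \<times> (S \<union> {u})"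
    using p(2) xy(1,2,4) yu unfolding c_def by auto
  moreover have "pcas u c u" using p(1) by (simp add: c_def pcas_append)
  moreover have "distinct (map snd c)"
    using p(3,4) \<open>u \<notin> snd ` set p\<close> xy(1) assms(2) by (auto simp: c_def)
  moreover have "3 \<le> length c" using \<open>p \<noteq> []\<close> by (cases p) (auto simp: c_def)
  moreover have "u \<in> fst ` set c" by (simp add: c_def)
  ultimately show ?L unfolding cycle_through_induce_iff
    by (intro exI[of _ u] exI[of _ c] conjI) (simp_all only: Un_iff singleton_iff simp_thms)
qed

text \<open>The working form of convexity, free of cycles; \<open>u\<close> is a vertex because it
  is the tail of an arc.\<close>

lemma cycle_convex_iff:
  assumes "pair_graph F"
  shows "cycle_convex F S \<longleftrightarrow> S \<subseteq> pverts F \<and>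
    (\<forall>u x y. (u, x) \<in> parcs F \<longrightarrow> (u, y) \<in> parcs F \<longrightarrow> x \<in> S \<longrightarrow> y \<in> S \<longrightarrow>
       (x, y) \<in> linked F S \<longrightarrow> x \<noteq> y \<longrightarrow> u \<in> S)"
    (is "?L \<longleftrightarrow> ?R")
proof -
  have *: "u \<in> pverts F" if "(u, x) \<in> parcs F" for u x
    using pair_graph_arcD[OF assms that] by blast
  show ?thesis
  proof
    assume "cycle_convex F S"
    then have "S \<subseteq> pverts F"
      and "\<And>u. u \<in> pverts F \<Longrightarrow> u \<notin> S \<Longrightarrow> \<not> (\<exists>x\<in>S. \<exists>y\<in>S. x \<noteq> y \<and> (u, x) \<in> parcs F \<and>
        (u, y) \<in> parcs F \<and> (x, y) \<in> linked F S)"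
      unfolding cycle_convex_def using cycle_through_insert_iff[OF assms] by auto
    then show ?R using * by blast
  next
    assume R: ?R
    then have "\<not> (\<exists>x\<in>S. \<exists>y\<in>S. x \<noteq> y \<and> (u, x) \<in> parcs F \<and> (u, y) \<in> parcs F \<and>
      (x, y) \<in> linked F S)" if "u \<notin> S" for u
      using that by blast
    then show ?L unfolding cycle_convex_def using R cycle_through_insert_iff[OF assms] by auto
  qed
qed

lemma cycle_convexI:
  assumes "pair_graph F" "S \<subseteq> pverts F"
    and "\<And>u x y. (u, x) \<in> parcs F \<Longrightarrow> (u, y) \<in> parcs F \<Longrightarrow> x \<in> S \<Longrightarrow> y \<in> S \<Longrightarrow>
       (x, y) \<in> linked F S \<Longrightarrow> u \<notin> S \<Longrightarrow> x = y"
  shows "cycle_convex F S"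
  unfolding cycle_convex_iff[OF assms(1)] using assms(2,3) by blast

lemma cycle_convexD:
  assumes "pair_graph F" "cycle_convex F S"
    and "(u, x) \<in> parcs F" "(u, y) \<in> parcs F" "x \<in> S" "y \<in> S" "(x, y) \<in> linked F S" "u \<notin> S"
  shows "x = y"
  using assms cycle_convex_iff by metis

lemma cycle_hull_subset_pverts: "S \<subseteq> pverts F \<Longrightarrow> cycle_hull F S \<subseteq> pverts F"
  using cycle_convex_cycle_hull cycle_convex_def by metis

lemma cycle_hull_eq: "cycle_convex F S \<Longrightarrow> cycle_hull F S = S"
  using cycle_hull_minimal[of S S F] subset_cycle_hull[of S F] by blast

lemma cycle_convex_singleton:
  assumes "pair_graph F" "x \<in> pverts F"
  shows "cycle_convex F {x}"
  by (rule cycle_convexI[OF assms(1)]) (use assms(2) in auto)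

lemma cycle_convex_empty: "pair_graph F \<Longrightarrow> cycle_convex F {}"
  by (rule cycle_convexI) auto

section \<open>Witnesses of independence and corners\<close>

text \<open>Only the exclusion half of Caratheodory independence; membership of \<open>p\<close> in
  the hull of \<open>X\<close> is a separate condition.\<close>

definition hull_witness :: "'a pair_pre_digraph \<Rightarrow> 'a set \<Rightarrow> 'a \<Rightarrow> bool" where
  "hull_witness F X p \<longleftrightarrow> (\<forall>a\<in>X. p \<notin> cycle_hull F (X - {a}))"

text \<open>
  The half of the product construction that lives in one factor. The last conjunct is weaker than
  \<^const>\<open>hull_witness\<close>: it also holds for a convex induced path \<open>X\<close> with ends \<open>x0\<close> and \<open>p\<close>.
\<close>

definition corner :: "'a pair_pre_digraph \<Rightarrow> 'a set \<Rightarrow> 'a \<Rightarrow> 'a \<Rightarrow> bool" where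
  "corner F X x0 p \<longleftrightarrow> X \<subseteq> pverts F \<and> x0 \<in> X \<and> p \<in> cycle_hull F X \<and>
     (\<forall>x\<in>cycle_hull F X. (x0, x) \<in> linked F (cycle_hull F X)) \<and>
     x0 \<notin> cycle_hull F (X - {x0}) \<and>
     (\<forall>a\<in>X - {x0}. (x0, p) \<notin> linked F (cycle_hull F (X - {a})))"

text \<open>
  If some \<open>a \<in> S\<close> lay outside the component of \<open>p\<close> in the hull, it would not contribute to \<open>p\<close>.
\<close>

lemma hull_witness_linked:
  assumes F: "pair_graph F" and S: "S \<subseteq> pverts F" and p: "p \<in> cycle_hull F S"
    and w: "hull_witness F S p" and x: "x \<in> cycle_hull F S"
  shows "(p, x) \<in> linked F (cycle_hull F S)"
proof -
  let ?A = "cycle_hull F S"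
  define C where "C = {x \<in> ?A. (p, x) \<in> linked F ?A}"
  have A: "cycle_convex F ?A" and AV: "?A \<subseteq> pverts F" and SA: "S \<subseteq> ?A"
    using cycle_convex_cycle_hull[OF S] cycle_hull_subset_pverts[OF S] subset_cycle_hull[of S F] by auto
  have CA: "C \<subseteq> ?A" unfolding C_def by auto
  have closed: "b \<in> C" if "a \<in> C" "b \<in> ?A" "(a, b) \<in> parcs F" for a b
    using that linked_step[of a b F ?A] unfolding C_def by (auto intro: linked_trans)
  have "S \<subseteq> C"
  proof (rule ccontr)
    assume "\<not> S \<subseteq> C"
    then obtain a where a: "a \<in> S" "a \<notin> C" by blast
    let ?T = "cycle_hull F (S - {a})"
    have T: "cycle_convex F ?T" "S - {a} \<subseteq> ?T"
      using cycle_convex_cycle_hull[of "S - {a}" F] subset_cycle_hull[of "S - {a}" F] S by blast+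
    \<comment> \<open>\<open>D\<close> shrinks the component \<open>C\<close> of \<open>p\<close> to
      its part in \<open>?T\<close> and keeps the rest of the hull. It is convex and contains
      \<open>S\<close>, as \<open>a\<close> lies in that rest; hence \<open>p\<close> would survive
      the removal of \<open>a\<close>.\<close>
    define D where "D = (?T \<inter> C) \<union> (?A - C)"
    have DA: "D \<subseteq> ?A" using CA unfolding D_def by blast
    have "cycle_convex F D"
    proof (rule cycle_convexI[OF F])
      show "D \<subseteq> pverts F" using DA AV by blast
      fix u x y assume u: "(u, x) \<in> parcs F" "(u, y) \<in> parcs F" "x \<in> D" "y \<in> D"
        "(x, y) \<in> linked F D" "u \<notin> D"
      have xy: "x \<in> ?A" "y \<in> ?A" using u DA by auto
      show "x = y"
      proof (cases "u \<in> ?A")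
        case False
        then show ?thesis using cycle_convexD[OF F A u(1,2) xy linked_mono[OF DA u(5)]] by blast
      next
        case True
        then have uC: "u \<in> C" "u \<notin> ?T" using u(6) unfolding D_def by auto
        have "x \<in> C" "y \<in> C" using closed[OF uC(1)] xy u by auto
        then have "(x, y) \<in> linked F (D \<inter> C)"
          using linked_closed_subset(1)[OF u(5), of C] closed DA by blast
        then have "(x, y) \<in> linked F ?T" by (rule linked_mono[rotated]) (auto simp: D_def)
        moreover have "x \<in> ?T" "y \<in> ?T" using \<open>x \<in> C\<close> \<open>y \<in> C\<close> u(3,4) unfolding D_def by auto
        ultimately show ?thesis using cycle_convexD[OF F T(1) u(1,2)] uC(2) by blast
      qed
    qed
    moreover have "S \<subseteq> D" using T(2) SA a unfolding D_def by blast
    ultimately have "p \<in> D" using cycle_hull_minimal p by blast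
    then have "p \<in> ?T" using p unfolding D_def C_def by simp
    then show False using w a(1) unfolding hull_witness_def by blast
  qed
  \<comment> \<open>A vertex of the hull adjacent to \<open>C\<close> already lies in
    \<open>C\<close>, and a vertex outside the hull is handled by the convexity of
    \<open>?A\<close>. As \<open>C\<close> contains \<open>S\<close>, it is the whole hull.\<close>
  moreover have "cycle_convex F C"
  proof (rule cycle_convexI[OF F])
    show "C \<subseteq> pverts F" using CA AV by blast
    fix u x y assume u: "(u, x) \<in> parcs F" "(u, y) \<in> parcs F" "x \<in> C" "y \<in> C"
      "(x, y) \<in> linked F C" "u \<notin> C"
    have "u \<notin> ?A" using closed[OF u(3) _ pair_graph_sym[OF F u(1)]] u(6) by blast
    then show "x = y"
      using cycle_convexD[OF F A u(1,2) _ _ linked_mono[OF CA u(5)]] u(3,4) CA by blast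
  qed
  ultimately have "?A \<subseteq> C" by (rule cycle_hull_minimal)
  then show ?thesis using x unfolding C_def by blast
qed

text \<open>Connectedness of the hull goes through \<open>p\<close>. If \<open>x0\<close> were in
  the hull of the other points, that hull would contain \<open>S\<close> and hence \<open>p\<close>;
  and a link from \<open>x0\<close> to \<open>p\<close> after removing \<open>a\<close> would put
  \<open>p\<close> into the smaller hull, since \<open>x0\<close> is still there.\<close>

lemma hull_witness_corner:
  assumes F: "pair_graph F" and S: "S \<subseteq> pverts F" and p: "p \<in> cycle_hull F S"
    and w: "hull_witness F S p" and x0: "x0 \<in> S"
  shows "corner F S x0 p"
proof -
  let ?A = "cycle_hull F S"
  have "(x0, x) \<in> linked F ?A" if "x \<in> ?A" for x
  proof -
    have "x0 \<in> ?A" using x0 subset_cycle_hull[of S F] by blast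
    then show ?thesis
      using hull_witness_linked[OF F S p w] linked_sym[OF F] that by (blast intro: linked_trans)
  qed
  moreover have "x0 \<notin> cycle_hull F (S - {x0})"
  proof
    assume "x0 \<in> cycle_hull F (S - {x0})"
    then have "S \<subseteq> cycle_hull F (S - {x0})" using subset_cycle_hull[of "S - {x0}" F] by blast
    then have "?A \<subseteq> cycle_hull F (S - {x0})"
      using cycle_convex_cycle_hull[of "S - {x0}" F] S by (intro cycle_hull_minimal) auto
    then show False using p w x0 unfolding hull_witness_def by blast
  qed
  moreover have "(x0, p) \<notin> linked F (cycle_hull F (S - {a}))" if "a \<in> S - {x0}" for a
  proof
    assume "(x0, p) \<in> linked F (cycle_hull F (S - {a}))"
    moreover have "x0 \<in> cycle_hull F (S - {a})"
      using that x0 subset_cycle_hull[of "S - {a}" F] by blast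
    ultimately have "p \<in> cycle_hull F (S - {a})" by (rule linked_in)
    then show False using w that unfolding hull_witness_def by blast
  qed
  ultimately show ?thesis using S p x0 unfolding corner_def by blast
qed

section \<open>Convex sets in Cartesian products\<close>

lemma parcs_cartesian_product:
  "((g1, h1), (g2, h2)) \<in> parcs (G \<box> H) \<longleftrightarrow>
     (g1, g2) \<in> parcs G \<and> h1 = h2 \<and> h1 \<in> pverts H \<or>
     g1 = g2 \<and> g1 \<in> pverts G \<and> (h1, h2) \<in> parcs H"
  by (simp add: cartesian_product_def)

lemma pverts_cartesian_product [simp]: "pverts (G \<box> H) = pverts G \<times> pverts H"
  by (simp add: cartesian_product_def)

lemma pair_graph_cartesian_product:
  assumes G: "pair_graph G" and H: "pair_graph H"
  shows "pair_graph (G \<box> H)"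
proof -
  have sub: "parcs (G \<box> H) \<subseteq> (pverts G \<times> pverts H) \<times> (pverts G \<times> pverts H)"
    using pair_graph_arcD[OF G] pair_graph_arcD[OF H] by (auto simp: parcs_cartesian_product)
  show ?thesis
  proof
    show "finite (pverts (G \<box> H))"
      using pair_graph_finite[OF G] pair_graph_finite[OF H] by simp
    then show "finite (parcs (G \<box> H))" using finite_subset[OF sub] by simp
    show "symmetric (with_proj (G \<box> H))"
      unfolding symmetric_def using pair_graph_sym[OF G] pair_graph_sym[OF H]
      by (auto simp: sym_def parcs_cartesian_product)
  next
    fix e assume e: "e \<in> parcs (G \<box> H)"
    then show "fst e \<in> pverts (G \<box> H)" "snd e \<in> pverts (G \<box> H)" using sub by auto
    show "fst e \<noteq> snd e"
      using e pair_graph_irrefl[OF G] pair_graph_irrefl[OF H]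
      by (cases e) (auto simp: parcs_cartesian_product)
  qed
qed

text \<open>Two neighbours of \<open>u\<close> in the same direction are treated by convexity of a
  factor. With one neighbour in each direction, linked points have first coordinates both in
  \<open>C\<close> or both outside it, because \<open>C\<close> is a union of components of
  \<open>Z\<close>. In the first case \<open>u\<close> lies in \<open>C \<times> B\<close>, in the
  second in \<open>(Z - C) \<times> {y0}\<close>.\<close>

lemma cycle_convex_cross_product:
  assumes G: "pair_graph G" and H: "pair_graph H"
    and Z: "cycle_convex G Z" and B: "cycle_convex H B" and y0: "y0 \<in> B" and C: "C \<subseteq> Z"
    and closed: "\<And>a b. a \<in> C \<Longrightarrow> b \<in> Z \<Longrightarrow> (a, b) \<in> parcs G \<Longrightarrow> b \<in> C"
  shows "cycle_convex (G \<box> H) (C \<times> B \<union> (Z - C) \<times> {y0})" (is "cycle_convex _ ?S")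
proof (rule cycle_convexI[OF pair_graph_cartesian_product[OF G H]])
  note PC = parcs_cartesian_product
  show "?S \<subseteq> pverts (G \<box> H)" using Z B y0 C unfolding cycle_convex_def by auto
  fix u x y assume u: "(u, x) \<in> parcs (G \<box> H)" "(u, y) \<in> parcs (G \<box> H)" "x \<in> ?S" "y \<in> ?S"
    and l: "(x, y) \<in> linked (G \<box> H) ?S" and uS: "u \<notin> ?S"
  have closed': "b \<in> C" if "a \<in> C" "b \<in> Z" "(b, a) \<in> parcs G" for a b
    using closed[OF that(1,2)] pair_graph_sym[OF G that(3)] .
  have SZ: "fst z \<in> Z" "snd z \<in> B" if "z \<in> ?S" for z using that C y0 by auto
  have l1: "(fst x, fst y) \<in> linked G Z"
    using l
  proof (rule linked_image)
    fix a b assume "(a, b) \<in> parcs (G \<box> H)" "a \<in> ?S" "b \<in> ?S"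
    then show "(fst a, fst b) \<in> linked G Z"
      using SZ[of a] SZ[of b] by (cases a, cases b) (auto simp: PC intro: linked_step)
  qed
  have l2: "(snd x, snd y) \<in> linked H B"
    using l
  proof (rule linked_image)
    fix a b assume "(a, b) \<in> parcs (G \<box> H)" "a \<in> ?S" "b \<in> ?S"
    then show "(snd a, snd b) \<in> linked H B"
      using SZ[of a] SZ[of b] by (cases a, cases b) (auto simp: PC intro: linked_step)
  qed
  have iff: "fst x \<in> C \<longleftrightarrow> fst y \<in> C"
    using linked_closed_subset(2)[OF l1, of C] linked_closed_subset(2)[OF linked_sym[OF G l1], of C]
      closed by blast
  obtain g h g1 h1 g2 h2 where eqs: "u = (g, h)" "x = (g1, h1)" "y = (g2, h2)"
    by (cases u, cases x, cases y)
  note u' = u(1,2)[unfolded eqs PC]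
  consider (hh) "h1 = h" "h2 = h" "(g, g1) \<in> parcs G" "(g, g2) \<in> parcs G"
    | (gg) "g1 = g" "g2 = g" "(h, h1) \<in> parcs H" "(h, h2) \<in> parcs H"
    | (gh) "g1 = g" "h2 = h" "(g, g2) \<in> parcs G"
    | (hg) "g2 = g" "h1 = h" "(g, g1) \<in> parcs G"
    using u' by blast
  then show "x = y"
  proof cases
    case hh
    \<comment> \<open>If \<open>g\<close> were in \<open>Z\<close>, then \<open>u\<close> would lie
      in the set: directly when \<open>h = y0\<close>, and otherwise because \<open>g1\<close> is in
      \<open>C\<close> and so is its neighbour \<open>g\<close>.\<close>
    have "g \<notin> Z"
    proof
      assume "g \<in> Z"
      then show False
        using uS u(3) hh closed'[of g1 g] y0 unfolding eqs by auto
    qed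
    then have "g1 = g2"
      using cycle_convexD[OF G Z hh(3,4)] l1 SZ[OF u(3)] SZ[OF u(4)] unfolding eqs by simp
    then show ?thesis using hh unfolding eqs by simp
  next
    case gg
    show ?thesis
    proof (cases "g \<in> C")
      case True
      then have "h \<notin> B" using uS unfolding eqs by simp
      then show ?thesis
        using cycle_convexD[OF H B gg(3,4)] l2 SZ[OF u(3)] SZ[OF u(4)] gg unfolding eqs by simp
    next
      case False
      then show ?thesis using u(3,4) gg unfolding eqs by auto
    qed
  next
    case gh
    then show ?thesis using uS u(3,4) iff y0 unfolding eqs by auto
  next
    case hg
    then show ?thesis using uS u(3,4) iff y0 unfolding eqs by auto
  qed
qed

text \<open>Transfers the preceding construction to the mirrored situation, where a point on the
  other arm of the cross is removed.\<close>

lemma cycle_convex_swap: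
  assumes G: "pair_graph G" and H: "pair_graph H" and S: "cycle_convex (G \<box> H) S"
  shows "cycle_convex (H \<box> G) (prod.swap ` S)"
proof (rule cycle_convexI[OF pair_graph_cartesian_product[OF H G]])
  show "prod.swap ` S \<subseteq> pverts (H \<box> G)" using S unfolding cycle_convex_def by auto
  have arcs: "(prod.swap a, prod.swap b) \<in> parcs (G \<box> H)" if "(a, b) \<in> parcs (H \<box> G)" for a b
    using that by (cases a, cases b) (auto simp: parcs_cartesian_product)
  have mem: "prod.swap a \<in> S \<longleftrightarrow> a \<in> prod.swap ` S" for a by force
  fix u x y assume u: "(u, x) \<in> parcs (H \<box> G)" "(u, y) \<in> parcs (H \<box> G)" "x \<in> prod.swap ` S"
    "y \<in> prod.swap ` S" "(x, y) \<in> linked (H \<box> G) (prod.swap ` S)" "u \<notin> prod.swap ` S"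
  have "(prod.swap x, prod.swap y) \<in> linked (G \<box> H) S"
    using u(5) by (rule linked_image) (simp add: linked_step arcs mem)
  then have "prod.swap x = prod.swap y"
    using cycle_convexD[OF pair_graph_cartesian_product[OF G H] S arcs[OF u(1)] arcs[OF u(2)]]
      u(3,4,6) by (simp add: mem)
  then show "x = y" by (metis swap_swap)
qed

text \<open>Since \<open>x0 \<notin> Z\<close> and \<open>y0 \<notin> W\<close>, points of different
  arms differ in both coordinates and are never adjacent. Linked points therefore share an arm,
  where convexity of one factor decides.\<close>

lemma cycle_convex_disjoint_fibres:
  assumes G: "pair_graph G" and H: "pair_graph H"
    and Z: "cycle_convex G Z" and W: "cycle_convex H W"
    and x0: "x0 \<in> pverts G" "x0 \<notin> Z" and y0: "y0 \<in> pverts H" "y0 \<notin> W"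
  shows "cycle_convex (G \<box> H) (Z \<times> {y0} \<union> {x0} \<times> W)" (is "cycle_convex _ ?S")
proof (rule cycle_convexI[OF pair_graph_cartesian_product[OF G H]])
  note PC = parcs_cartesian_product
  show "?S \<subseteq> pverts (G \<box> H)" using Z W x0 y0 unfolding cycle_convex_def by auto
  fix u x y assume u: "(u, x) \<in> parcs (G \<box> H)" "(u, y) \<in> parcs (G \<box> H)" "x \<in> ?S" "y \<in> ?S"
    and l: "(x, y) \<in> linked (G \<box> H) ?S" and uS: "u \<notin> ?S"
  obtain g h g1 h1 g2 h2 where eqs: "u = (g, h)" "x = (g1, h1)" "y = (g2, h2)"
    by (cases u, cases x, cases y)
  show "x = y"
  proof (cases "x \<in> Z \<times> {y0}")
    case True
    have "b \<in> Z \<times> {y0}" if "a \<in> Z \<times> {y0}" "b \<in> ?S" "(a, b) \<in> parcs (G \<box> H)" for a b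
      using that x0 y0 by (auto simp: PC)
    note * = linked_closed_subset[OF l True this]
    have "(fst x, fst y) \<in> linked G Z"
      using *(1) by (rule linked_image) (auto simp: PC intro: linked_step)
    then have "g1 = g2" if "h = y0" "g \<notin> Z"
      using cycle_convexD[OF G Z, of g g1 g2] that True *(2) u(1,2) pair_graph_irrefl[OF H]
      unfolding eqs by (auto simp: PC)
    then show ?thesis using True *(2) u(1,2) uS unfolding eqs by (auto simp: PC)
  next
    case False
    then have xW: "x \<in> {x0} \<times> W" using u(3) by blast
    have "b \<in> {x0} \<times> W" if "a \<in> {x0} \<times> W" "b \<in> ?S" "(a, b) \<in> parcs (G \<box> H)" for a b
      using that x0 y0 by (auto simp: PC)
    note * = linked_closed_subset[OF l xW this]
    have "(snd x, snd y) \<in> linked H W"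
      using *(1) by (rule linked_image) (auto simp: PC intro: linked_step)
    then have "h1 = h2" if "g = x0" "h \<notin> W"
      using cycle_convexD[OF H W, of h h1 h2] that xW *(2) u(1,2) pair_graph_irrefl[OF G]
      unfolding eqs by (auto simp: PC)
    then show ?thesis using xW *(2) u(1,2) uS unfolding eqs by (auto simp: PC)
  qed
qed

lemma cycle_convex_fibre:
  assumes G: "pair_graph G" and H: "pair_graph H" and T: "cycle_convex (G \<box> H) T"
  shows "h \<in> pverts H \<Longrightarrow> cycle_convex G {g. (g, h) \<in> T}"
    and "g \<in> pverts G \<Longrightarrow> cycle_convex H {h. (g, h) \<in> T}"
proof -
  note PC = parcs_cartesian_product
  note D = cycle_convexD[OF pair_graph_cartesian_product[OF G H] T]
  have TV: "T \<subseteq> pverts G \<times> pverts H" using T unfolding cycle_convex_def by simp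
  show "cycle_convex G {g. (g, h) \<in> T}" if h: "h \<in> pverts H"
  proof (rule cycle_convexI[OF G])
    fix u x y assume u: "(u, x) \<in> parcs G" "(u, y) \<in> parcs G" "x \<in> {g. (g, h) \<in> T}"
      "y \<in> {g. (g, h) \<in> T}" "(x, y) \<in> linked G {g. (g, h) \<in> T}" "u \<notin> {g. (g, h) \<in> T}"
    have "((x, h), (y, h)) \<in> linked (G \<box> H) T"
      using u(5) by (rule linked_image) (auto simp: PC h intro: linked_step)
    then show "x = y" using D[of "(u, h)" "(x, h)" "(y, h)"] u h by (auto simp: PC)
  qed (use TV in auto)
  show "cycle_convex H {h. (g, h) \<in> T}" if g: "g \<in> pverts G"
  proof (rule cycle_convexI[OF H])
    fix u x y assume u: "(u, x) \<in> parcs H" "(u, y) \<in> parcs H" "x \<in> {h. (g, h) \<in> T}"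
      "y \<in> {h. (g, h) \<in> T}" "(x, y) \<in> linked H {h. (g, h) \<in> T}" "u \<notin> {h. (g, h) \<in> T}"
    have "((g, x), (g, y)) \<in> linked (G \<box> H) T"
      using u(5) by (rule linked_image) (auto simp: PC g intro: linked_step)
    then show "x = y" using D[of "(g, u)" "(g, x)" "(g, y)"] u g by (auto simp: PC)
  qed (use TV in auto)
qed

text \<open>Three corners of a square in the product generate the fourth, so a cross generates a box.\<close>

lemma cross_hull_superset:
  assumes G: "pair_graph G" and H: "pair_graph H"
    and X: "X \<subseteq> pverts G" "x0 \<in> X" and Y: "Y \<subseteq> pverts H" "y0 \<in> Y"
    and A: "\<And>x. x \<in> cycle_hull G X \<Longrightarrow> (x0, x) \<in> linked G (cycle_hull G X)"
    and B: "\<And>y. y \<in> cycle_hull H Y \<Longrightarrow> (y0, y) \<in> linked H (cycle_hull H Y)"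
  shows "cycle_hull G X \<times> cycle_hull H Y \<subseteq> cycle_hull (G \<box> H) (X \<times> {y0} \<union> {x0} \<times> Y)"
    (is "?A \<times> ?B \<subseteq> ?T")
proof -
  note PC = parcs_cartesian_product
  have sub: "X \<times> {y0} \<union> {x0} \<times> Y \<subseteq> pverts (G \<box> H)" using X Y by auto
  have T: "cycle_convex (G \<box> H) ?T" using cycle_convex_cycle_hull[OF sub] .
  have AV: "?A \<subseteq> pverts G" and BV: "?B \<subseteq> pverts H"
    using cycle_hull_subset_pverts X(1) Y(1) by blast+
  have mem: "X \<times> {y0} \<union> {x0} \<times> Y \<subseteq> ?T" by (rule subset_cycle_hull)
  have x0A: "x0 \<in> ?A" and y0B: "y0 \<in> ?B"
    using X(2) Y(2) subset_cycle_hull[of X G] subset_cycle_hull[of Y H] by blast+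
  have row: "?A \<subseteq> {g. (g, y0) \<in> ?T}"
    using mem X Y by (intro cycle_hull_minimal cycle_convex_fibre(1)[OF G H T]) auto
  have col: "?B \<subseteq> {h. (x0, h) \<in> ?T}"
    using mem X Y by (intro cycle_hull_minimal cycle_convex_fibre(2)[OF G H T]) auto
  have square: "(g', h') \<in> ?T"
    if "(g, g') \<in> parcs G" "(h, h') \<in> parcs H" "(g, h) \<in> ?T" "(g', h) \<in> ?T" "(g, h') \<in> ?T"
    for g g' h h'
  proof (rule ccontr)
    assume n: "(g', h') \<notin> ?T"
    note V = pair_graph_arcD[OF G that(1)] pair_graph_arcD[OF H that(2)]
    have "((g', h), (g, h)) \<in> linked (G \<box> H) ?T" "((g, h), (g, h')) \<in> linked (G \<box> H) ?T"
      using that V pair_graph_sym[OF G that(1)] by (auto intro!: linked_step simp: PC)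
    then have "((g', h), (g, h')) \<in> linked (G \<box> H) ?T" by (rule linked_trans)
    then have "(g', h) = (g, h')"
      using cycle_convexD[OF pair_graph_cartesian_product[OF G H] T, of "(g', h')" "(g', h)" "(g, h')"]
        that V n pair_graph_sym[OF G that(1)] pair_graph_sym[OF H that(2)] by (auto simp: PC)
    then show False using n that by auto
  qed
  \<comment> \<open>The outer induction moves a full copy of \<open>?B\<close> from \<open>g\<close>
    to a neighbour \<open>g'\<close>, starting with the column at \<open>x0\<close>; the inner one
    starts on the row at \<open>y0\<close> and completes one square at a time.\<close>
  have "\<forall>h\<in>?B. (g, h) \<in> ?T" if "g \<in> ?A" for g
    using A[OF that] unfolding linked_def
  proof (induct rule: rtrancl_induct)
    case base
    then show ?case using col by blast
  next
    case (step g g')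
    show ?case
    proof
      fix h assume "h \<in> ?B"
      from B[OF this] show "(g', h) \<in> ?T" unfolding linked_def
      proof (induct rule: rtrancl_induct)
        case base
        then show ?case using row step by blast
      next
        case (step h h')
        then show ?case using square[of g g' h h'] \<open>(g, g') \<in> _\<close> \<open>\<forall>h\<in>?B. (g, h) \<in> ?T\<close> by blast
      qed
    qed
  qed
  then show ?thesis by blast
qed

section \<open>Independence of a cross\<close>

text \<open>After removing a point of the row, the points of the enclosing convex set whose first
  coordinate is not linked to \<open>x0\<close> occur only at height \<open>y0\<close>. So
  \<open>(p, q)\<close> is avoided there if \<open>q \<noteq> y0\<close> or if \<open>p\<close> is a
  genuine witness; the same alternative, with its mirror image, handles the removal of the
  centre.\<close>

lemma caratheodory_independent_cross:
  assumes G: "pair_graph G" and H: "pair_graph H"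
    and X: "corner G X x0 p" and Y: "corner H Y y0 q"
    and Xq: "hull_witness G X p \<or> q \<noteq> y0" and Yp: "hull_witness H Y q \<or> p \<noteq> x0"
  shows "caratheodory_independent (G \<box> H) (X \<times> {y0} \<union> {x0} \<times> Y)"
proof -
  let ?S = "X \<times> {y0} \<union> {x0} \<times> Y"
  note X' = X[unfolded corner_def] and Y' = Y[unfolded corner_def]
  have "?S \<subseteq> pverts (G \<box> H)" using X' Y' by auto
  moreover have "(p, q) \<in> cycle_hull (G \<box> H) ?S"
    using cross_hull_superset[OF G H, of X x0 Y y0] X' Y' by blast
  moreover have "(p, q) \<notin> cycle_hull (G \<box> H) (?S - {e})" if e: "e \<in> ?S" for e
  proof -
    have conv: "cycle_convex G (cycle_hull G (X - M))" "cycle_convex H (cycle_hull H (Y - N))"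
      "X - M \<subseteq> cycle_hull G (X - M)" "Y - N \<subseteq> cycle_hull H (Y - N)" for M N
      using X' Y' by (blast intro: cycle_convex_cycle_hull subset_cycle_hull[THEN subsetD])+
    have convXY: "cycle_convex G (cycle_hull G X)" "cycle_convex H (cycle_hull H Y)"
      "X \<subseteq> cycle_hull G X" "Y \<subseteq> cycle_hull H Y"
      using conv(1,3)[of "{}"] conv(2,4)[of "{}"] by simp_all
    consider "e = (x0, y0)" | a where "e = (a, y0)" "a \<in> X - {x0}"
      | b where "e = (x0, b)" "b \<in> Y - {y0}"
      using e by blast
    then show ?thesis
    proof cases
      case 1
      let ?Z = "cycle_hull G (X - {x0})" and ?W = "cycle_hull H (Y - {y0})"
      have "cycle_convex (G \<box> H) (?Z \<times> {y0} \<union> {x0} \<times> ?W)"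
        using X' Y' by (intro cycle_convex_disjoint_fibres[OF G H] conv) auto
      moreover have "?S - {e} \<subseteq> ?Z \<times> {y0} \<union> {x0} \<times> ?W"
        using conv(3)[of "{x0}"] conv(4)[of "{y0}"] unfolding 1 by blast
      ultimately have "cycle_hull (G \<box> H) (?S - {e}) \<subseteq> ?Z \<times> {y0} \<union> {x0} \<times> ?W"
        by (intro cycle_hull_minimal)
      moreover have "(p, q) \<notin> ?Z \<times> {y0} \<union> {x0} \<times> ?W"
        using Xq Yp X' Y' unfolding hull_witness_def by auto
      ultimately show ?thesis by blast
    next
      case (2 a)
      let ?Z = "cycle_hull G (X - {a})" and ?B = "cycle_hull H Y"
      define C where "C = {x \<in> ?Z. (x0, x) \<in> linked G ?Z}"
      have closed: "d \<in> C" if "c \<in> C" "d \<in> ?Z" "(c, d) \<in> parcs G" for c d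
        using that linked_step[of c d G ?Z] unfolding C_def by (auto intro: linked_trans)
      have "cycle_convex (G \<box> H) (C \<times> ?B \<union> (?Z - C) \<times> {y0})"
        using Y' convXY closed
        by (intro cycle_convex_cross_product[OF G H] conv) (auto simp: C_def)
      moreover have "x0 \<in> C" using X' 2 conv(3)[of "{a}"] unfolding C_def by auto
      then have "?S - {e} \<subseteq> C \<times> ?B \<union> (?Z - C) \<times> {y0}"
        using conv(3)[of "{a}"] convXY(4) Y' unfolding 2 by blast
      ultimately have "cycle_hull (G \<box> H) (?S - {e}) \<subseteq> C \<times> ?B \<union> (?Z - C) \<times> {y0}"
        by (intro cycle_hull_minimal)
      moreover have "(p, q) \<notin> C \<times> ?B \<union> (?Z - C) \<times> {y0}"
        using Xq X' 2 unfolding hull_witness_def C_def by auto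
      ultimately show ?thesis by blast
    next
      case (3 b)
      let ?W = "cycle_hull H (Y - {b})" and ?A = "cycle_hull G X"
      define C where "C = {y \<in> ?W. (y0, y) \<in> linked H ?W}"
      have closed: "d \<in> C" if "c \<in> C" "d \<in> ?W" "(c, d) \<in> parcs H" for c d
        using that linked_step[of c d H ?W] unfolding C_def by (auto intro: linked_trans)
      have "cycle_convex (H \<box> G) (C \<times> ?A \<union> (?W - C) \<times> {x0})"
        using X' convXY closed
        by (intro cycle_convex_cross_product[OF H G] conv) (auto simp: C_def)
      then have "cycle_convex (G \<box> H) (prod.swap ` (C \<times> ?A \<union> (?W - C) \<times> {x0}))"
        by (rule cycle_convex_swap[OF H G])
      moreover have "prod.swap ` (C \<times> ?A \<union> (?W - C) \<times> {x0}) = ?A \<times> C \<union> {x0} \<times> (?W - C)"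
        by force
      moreover have "y0 \<in> C" using Y' 3 conv(4)[of "{b}"] unfolding C_def by auto
      then have "?S - {e} \<subseteq> ?A \<times> C \<union> {x0} \<times> (?W - C)"
        using conv(4)[of "{b}"] convXY(3) X' unfolding 3 by blast
      ultimately have "cycle_hull (G \<box> H) (?S - {e}) \<subseteq> ?A \<times> C \<union> {x0} \<times> (?W - C)"
        by (intro cycle_hull_minimal) auto
      moreover have "(p, q) \<notin> ?A \<times> C \<union> {x0} \<times> (?W - C)"
        using Yp Y' 3 unfolding hull_witness_def C_def by auto
      ultimately show ?thesis by blast
    qed
  qed
  ultimately show ?thesis unfolding caratheodory_independent_def by blast
qed

section \<open>Induced paths and their convex subsets\<close>

text \<open>A list of vertices instead of the arcs in \<open>induced_path_verts\<close>, so that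
  prefixes and gaps can be described by positions.\<close>

definition induced_path_list :: "'a pair_pre_digraph \<Rightarrow> 'a list \<Rightarrow> bool" where
  "induced_path_list F xs \<longleftrightarrow> xs \<noteq> [] \<and> distinct xs \<and>
     (\<forall>i<length xs. \<forall>j<length xs. (xs ! i, xs ! j) \<in> parcs F \<longleftrightarrow> i = Suc j \<or> j = Suc i)"

lemma pcas_nth:
  assumes "pcas u p v" "i < length p"
  shows "p ! i = (pawalk_verts u p ! i, pawalk_verts u p ! Suc i)"
  using assms
proof (induct p arbitrary: u i)
  case (Cons e p)
  have "pawalk_verts (snd e) p ! 0 = snd e" using Cons.prems by (cases p) auto
  then show ?case using Cons by (cases i) auto
qed simp

text \<open>The list is the vertex sequence of the path: arc number \<open>i\<close> joins entries
  \<open>i\<close> and \<open>Suc i\<close>, and distinctness recovers these positions from the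
  arc.\<close>

lemma induced_path_verts_imp_list:
  assumes "induced_path_verts F X"
  obtains xs where "induced_path_list F xs" "set xs = X"
proof -
  from assms obtain u p v where path: "pre_digraph.apath (with_proj F) u p v"
    and X: "X = set (pawalk_verts u p)"
    and arcs: "arcs (with_proj F \<restriction> X) = set p \<union> (set p)\<inverse>"
    unfolding induced_path_verts_def awalk_verts_with_proj_eq by blast
  define xs where "xs = pawalk_verts u p"
  have p: "pcas u p v" "distinct xs"
    using path unfolding pre_digraph.apath_def pre_digraph.awalk_def awalk_verts_with_proj_eq
      cas_with_proj_eq xs_def by auto
  have len: "length xs = Suc (length p)" unfolding xs_def by (induct p arbitrary: u) auto
  have arc: "(a, b) \<in> parcs F \<longleftrightarrow> (a, b) \<in> set p \<or> (b, a) \<in> set p" if "a \<in> X" "b \<in> X" for a b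
  proof -
    have "(a, b) \<in> arcs (with_proj F \<restriction> X) \<longleftrightarrow> (a, b) \<in> parcs F"
      using that by (simp add: induce_subgraph_def)
    then show ?thesis unfolding arcs by simp
  qed
  have step: "(xs ! i, xs ! j) \<in> set p \<longleftrightarrow> j = Suc i" if ij: "i < length xs" "j < length xs" for i j
  proof
    assume "(xs ! i, xs ! j) \<in> set p"
    then obtain k where "k < length p" "p ! k = (xs ! i, xs ! j)" by (auto simp: in_set_conv_nth)
    then have "xs ! i = xs ! k" "xs ! j = xs ! Suc k" "k < length xs" "Suc k < length xs"
      using pcas_nth[OF p(1)] len unfolding xs_def by auto
    then show "j = Suc i" using p(2) ij by (simp add: nth_eq_iff_index_eq)
  next
    assume "j = Suc i"
    then show "(xs ! i, xs ! j) \<in> set p"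
      using pcas_nth[OF p(1), of i] ij len nth_mem[of i p] unfolding xs_def by simp
  qed
  have "induced_path_list F xs"
    unfolding induced_path_list_def
  proof (intro conjI allI impI)
    show "xs \<noteq> []" using len by auto
    fix i j assume ij: "i < length xs" "j < length xs"
    then show "(xs ! i, xs ! j) \<in> parcs F \<longleftrightarrow> i = Suc j \<or> j = Suc i"
      using arc[of "xs ! i" "xs ! j"] step[of i j] step[of j i] X unfolding xs_def[symmetric] by auto
  qed (rule p(2))
  then show ?thesis using that X unfolding xs_def by blast
qed

lemma induced_path_list_take:
  assumes "induced_path_list F xs" "0 < m"
  shows "induced_path_list F (take m xs)"
  using assms unfolding induced_path_list_def by auto

text \<open>Every arc changes the position by exactly one, so without position \<open>k\<close> the
  positions below \<open>k\<close> cannot be left inside \<open>X\<close>.\<close>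

lemma induced_path_list_separates:
  assumes xs: "induced_path_list F xs" and X: "X \<subseteq> set xs"
    and k: "xs ! k \<notin> X" "i < k" "k < j" "j < length xs"
  shows "(xs ! i, xs ! j) \<notin> linked F X"
proof
  assume l: "(xs ! i, xs ! j) \<in> linked F X"
  have d: "distinct xs" using xs unfolding induced_path_list_def by blast
  let ?C = "{xs ! n | n. n < k}"
  have "xs ! j \<in> ?C"
    using l
  proof (rule linked_closed_subset(2))
    show "xs ! i \<in> ?C" using k by blast
    fix a b assume ab: "a \<in> ?C" "b \<in> X" "(a, b) \<in> parcs F"
    then obtain n where n: "a = xs ! n" "n < k" by blast
    obtain m where m: "b = xs ! m" "m < length xs" using ab(2) X by (metis in_set_conv_nth subsetD)
    have "m \<noteq> k" using ab(2) k(1) m by blast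
    moreover have "n = Suc m \<or> m = Suc n"
      using xs ab(3) n m k unfolding induced_path_list_def by auto
    ultimately show "b \<in> ?C" using n m by auto
  qed
  then obtain n where "xs ! j = xs ! n" "n < k" by blast
  then show False using d k by (simp add: nth_eq_iff_index_eq)
qed

text \<open>A vertex off the path is excluded by convexity of the whole path. A path vertex missing
  from \<open>X\<close> has its path neighbours on opposite sides, and these are not linked in
  \<open>X\<close>.\<close>

lemma cycle_convex_subset_path:
  assumes F: "pair_graph F" and xs: "induced_path_list F xs" and P: "cycle_convex F (set xs)"
    and X: "X \<subseteq> set xs"
  shows "cycle_convex F X"
proof (rule cycle_convexI[OF F])
  show "X \<subseteq> pverts F" using X P unfolding cycle_convex_def by blast
  fix u x y assume u: "(u, x) \<in> parcs F" "(u, y) \<in> parcs F" "x \<in> X" "y \<in> X"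
    "(x, y) \<in> linked F X" "u \<notin> X"
  show "x = y"
  proof (cases "u \<in> set xs")
    case False
    then show ?thesis using cycle_convexD[OF F P u(1,2)] u(3,4) X linked_mono[OF X u(5)] by blast
  next
    case True
    then obtain k where k: "u = xs ! k" "k < length xs" by (metis in_set_conv_nth)
    obtain i j where i: "x = xs ! i" "i < length xs" and j: "y = xs ! j" "j < length xs"
      using u(3,4) X by (metis in_set_conv_nth subsetD)
    have adj: "k = Suc i \<or> i = Suc k" "k = Suc j \<or> j = Suc k"
      using xs u(1,2) k i j unfolding induced_path_list_def by auto
    have "\<not> (i < k \<and> k < j)" "\<not> (j < k \<and> k < i)"
      using induced_path_list_separates[OF xs X] u(5,6) linked_sym[OF F u(5)] k i j by blast+
    then have "i = j" using adj by linarith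
    then show ?thesis using i j by simp
  qed
qed

section \<open>Corners from paths and from triangles\<close>

text \<open>All subsets of the path are their own hulls, so only connectivity remains: removing an
  inner vertex separates the ends, and removing the last vertex leaves nothing to reach.\<close>

lemma corner_path:
  assumes F: "pair_graph F" and xs: "induced_path_list F xs"
    and convex: "\<And>X. X \<subseteq> set xs \<Longrightarrow> cycle_convex F X"
  shows "corner F (set xs) (hd xs) (last xs)"
proof -
  have hull: "cycle_hull F X = X" if "X \<subseteq> set xs" for X using cycle_hull_eq[OF convex[OF that]] .
  have ne: "xs \<noteq> []" and d: "distinct xs" using xs unfolding induced_path_list_def by auto
  have hd: "hd xs = xs ! 0" and last: "last xs = xs ! (length xs - 1)"
    using ne by (simp_all add: hd_conv_nth last_conv_nth)
  have "(hd xs, xs ! i) \<in> linked F (set xs)" if "i < length xs" for i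
    using that
  proof (induct i)
    case (Suc i)
    then have "(xs ! i, xs ! Suc i) \<in> parcs F" using xs unfolding induced_path_list_def by auto
    then have "(xs ! i, xs ! Suc i) \<in> linked F (set xs)" using Suc.prems by (auto intro: linked_step)
    then show ?case using Suc by (auto intro: linked_trans)
  qed (simp add: hd)
  then have "\<forall>x\<in>set xs. (hd xs, x) \<in> linked F (set xs)" by (auto simp: in_set_conv_nth)
  moreover have "(hd xs, last xs) \<notin> linked F (set xs - {a})" if a: "a \<in> set xs - {hd xs}" for a
  proof
    assume l: "(hd xs, last xs) \<in> linked F (set xs - {a})"
    have "hd xs \<in> set xs - {a}" using ne a by auto
    then have "last xs \<noteq> a" using linked_in[OF l] by blast
    obtain k where k: "a = xs ! k" "k < length xs" using a by (metis DiffD1 in_set_conv_nth)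
    have "k \<noteq> 0" using a k hd by (cases k) auto
    moreover have "k \<noteq> length xs - 1" using \<open>last xs \<noteq> a\<close> k last by auto
    ultimately show False
      using induced_path_list_separates[OF xs, of "set xs - {a}" k 0 "length xs - 1"] l k
      unfolding hd last by auto
  qed
  ultimately show ?thesis
    unfolding corner_def using hull ne convex[of "set xs"] by (auto simp: cycle_convex_def)
qed

text \<open>Single vertices are convex, so neither \<open>x\<close> nor \<open>y\<close> alone
  generates the common neighbour \<open>z\<close>, whereas the arc between them does.\<close>

lemma corner_triangle:
  assumes F: "pair_graph F" and t: "(x, y) \<in> parcs F" "(x, z) \<in> parcs F" "(y, z) \<in> parcs F"
  shows "corner F {x, y} x z" and "hull_witness F {x, y} z"
proof -
  have ne: "x \<noteq> y" "x \<noteq> z" "y \<noteq> z" using t pair_graph_irrefl[OF F] by auto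
  have V: "x \<in> pverts F" "y \<in> pverts F" using pair_graph_arcD[OF F t(1)] by auto
  have "{x, y} - {x} = {y}" "{x, y} - {y} = {x}" using ne by auto
  then show w: "hull_witness F {x, y} z"
    using ne V by (simp add: hull_witness_def cycle_hull_eq[OF cycle_convex_singleton[OF F]])
  have sub: "{x, y} \<subseteq> pverts F" using V by simp
  have "z \<in> cycle_hull F {x, y}"
  proof (rule ccontr)
    assume "z \<notin> cycle_hull F {x, y}"
    moreover have xy: "x \<in> cycle_hull F {x, y}" "y \<in> cycle_hull F {x, y}"
      using subset_cycle_hull[of "{x, y}" F] by auto
    ultimately show False
      using cycle_convexD[OF F cycle_convex_cycle_hull[OF sub], of z x y] linked_step[OF t(1) xy]
        pair_graph_sym[OF F] t ne by blast
  qed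
  then show "corner F {x, y} x z" using hull_witness_corner[OF F sub _ w] by simp
qed

section \<open>Attaining the maxima\<close>

lemma finite_vertex_set_cards:
  assumes "pair_graph F" "\<And>X. P X \<Longrightarrow> X \<subseteq> pverts F"
  shows "finite {card X | X. P X}"
proof -
  have "{card X | X. P X} \<subseteq> {..card (pverts F)}"
    using assms(2) card_mono[OF pair_graph_finite[OF assms(1)]] by auto
  then show ?thesis using finite_subset by blast
qed

lemma card_le_car:
  assumes "pair_graph F" "caratheodory_independent F S"
  shows "card S \<le> car F"
  unfolding car_def
  using assms by (intro Max_ge finite_vertex_set_cards) (auto simp: caratheodory_independent_def)

text \<open>Singletons are independent, so the maximum exists. The empty set has empty hull, so a
  maximum set has an element, and any element can serve as \<open>x0\<close>.\<close>

lemma car_attained: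
  assumes F: "pair_graph F" and "pverts F \<noteq> {}"
  obtains S x0 p where "corner F S x0 p" "hull_witness F S p" "card S = car F"
proof -
  from assms obtain v where v: "v \<in> pverts F" by blast
  have "caratheodory_independent F {v}"
    using v by (simp add: caratheodory_independent_def cycle_hull_eq[OF cycle_convex_singleton[OF F]]
        cycle_hull_eq[OF cycle_convex_empty[OF F]])
  then have "car F \<in> {card S | S. caratheodory_independent F S}"
    unfolding car_def
    by (intro Max_in finite_vertex_set_cards[OF F]) (blast | simp add: caratheodory_independent_def)+
  then obtain S p where S: "card S = car F" "S \<subseteq> pverts F" "p \<in> cycle_hull F S" "hull_witness F S p"
    by (auto simp: caratheodory_independent_def hull_witness_def)
  have "S \<noteq> {}" using S(3) cycle_hull_eq[OF cycle_convex_empty[OF F]] by auto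
  then obtain x0 where "x0 \<in> S" by blast
  then show ?thesis using that hull_witness_corner[OF F S(2-4)] S by blast
qed

lemma convex_path_le_max:
  assumes "pair_graph F" "induced_path_verts F X" "cycle_convex F X"
  shows "card X \<le> max_convex_induced_path F"
  unfolding max_convex_induced_path_def
  using assms by (intro Max_ge finite_vertex_set_cards) (auto simp: cycle_convex_def)

lemma max_convex_induced_path_attained:
  assumes F: "pair_graph F" and "pverts F \<noteq> {}"
  obtains xs where "induced_path_list F xs" "cycle_convex F (set xs)"
    "length xs = max_convex_induced_path F"
proof -
  from assms obtain v where v: "v \<in> pverts F" by blast
  have "arcs (with_proj F \<restriction> {v}) = {}"
    using pair_graph_irrefl[OF F] by (auto simp: induce_subgraph_def)
  \<comment> \<open>The path without arcs shows that the maximum ranges over a nonempty set.\<close>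
  then have "induced_path_verts F {v}"
    unfolding induced_path_verts_def pre_digraph.apath_def pre_digraph.awalk_def
      awalk_verts_with_proj_eq cas_with_proj_eq
    using v by (intro exI[of _ v] exI[of _ "[]"]) auto
  then have "max_convex_induced_path F \<in> {card X | X. induced_path_verts F X \<and> cycle_convex F X}"
    unfolding max_convex_induced_path_def using cycle_convex_singleton[OF F v]
    by (intro Max_in finite_vertex_set_cards[OF F]) (auto simp: cycle_convex_def)
  then obtain X where X: "induced_path_verts F X" "cycle_convex F X"
    "card X = max_convex_induced_path F" by auto
  obtain xs where xs: "induced_path_list F xs" "set xs = X"
    using induced_path_verts_imp_list[OF X(1)] .
  then have "length xs = card X"
    using distinct_card[of xs] unfolding induced_path_list_def by simp
  then show ?thesis using that xs X by simp
qed

text \<open>Prefixes of a convex induced path are convex induced paths. Lengths below the maximum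
  are needed when the other factor supplies a triangle.\<close>

lemma corner_prefix_of_max_path:
  assumes F: "pair_graph F" and "pverts F \<noteq> {}" and m: "1 \<le> m" "m \<le> max_convex_induced_path F"
  obtains X x0 p where "corner F X x0 p" "card X = m" "2 \<le> m \<Longrightarrow> p \<noteq> x0"
proof -
  obtain xs where xs: "induced_path_list F xs" "cycle_convex F (set xs)"
    "length xs = max_convex_induced_path F"
    using max_convex_induced_path_attained[OF F assms(2)] .
  let ?ys = "take m xs"
  have len: "length ?ys = m" using xs(3) m by simp
  have path: "induced_path_list F ?ys" using induced_path_list_take[OF xs(1)] m by simp
  then have ys: "distinct ?ys" "?ys \<noteq> []" unfolding induced_path_list_def by blast+
  have "corner F (set ?ys) (hd ?ys) (last ?ys)"
    using cycle_convex_subset_path[OF F xs(1,2)] set_take_subset[of m xs]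
    by (intro corner_path[OF F path]) blast
  moreover have "card (set ?ys) = m" using distinct_card[OF ys(1)] len by simp
  moreover have "last ?ys \<noteq> hd ?ys" if "2 \<le> m"
  proof -
    have "last ?ys = ?ys ! (m - 1)" "hd ?ys = ?ys ! 0"
      using last_conv_nth[OF ys(2)] hd_conv_nth[OF ys(2)] unfolding len by blast+
    then show ?thesis using nth_eq_iff_index_eq[OF ys(1), of "m - 1" 0] len that by simp
  qed
  ultimately show ?thesis using that by blast
qed

lemma connected_obtains_arc:
  assumes F: "pair_graph F" and "Digraph_Component.connected (with_proj F)" "card (pverts F) \<ge> 2"
  obtains x y where "(x, y) \<in> parcs F"
proof -
  from assms(3) obtain v w where vw: "v \<in> pverts F" "w \<in> pverts F" "v \<noteq> w"
    by (metis card_le_Suc0_iff_eq not_less_eq_eq numeral_2_eq_2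
        pair_graph_finite[OF F])
  have "v \<rightarrow>\<^sup>*\<^bsub>with_proj (mk_symmetric (with_proj F))\<^esub> w"
    using assms(2) vw unfolding connected_def strongly_connected_def by simp
  from reachable_rtranclI[OF this] have "parcs (mk_symmetric (with_proj F)) \<noteq> {}" using vw(3) by auto
  then show ?thesis using that by (auto simp: mk_symmetric_def)
qed

text \<open>An edge whose ends have no common neighbour is itself a convex induced path on two
  vertices.\<close>

lemma short_max_path_obtains_triangle:
  assumes F: "pair_graph F" and xy: "(x, y) \<in> parcs F" and r: "max_convex_induced_path F < 2"
  obtains z where "(x, z) \<in> parcs F" "(y, z) \<in> parcs F"
proof (rule ccontr)
  assume "\<not> thesis"
  then have no: "\<not> ((x, z) \<in> parcs F \<and> (y, z) \<in> parcs F)" for z using that by blast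
  note sym = pair_graph_sym[OF F] and V = pair_graph_arcD[OF F xy]
  have ne: "x \<noteq> y" using xy pair_graph_irrefl[OF F] by auto
  have "cycle_convex F {x, y}"
    using V no sym by (intro cycle_convexI[OF F]) blast+
  moreover have arcs: "arcs (with_proj F \<restriction> {x, y}) = set [(x, y)] \<union> (set [(x, y)])\<inverse>"
    using xy sym[OF xy] pair_graph_irrefl[OF F] by (auto simp: induce_subgraph_def)
  have "induced_path_verts F {x, y}"
    unfolding induced_path_verts_def pre_digraph.apath_def pre_digraph.awalk_def
      awalk_verts_with_proj_eq cas_with_proj_eq
    using V ne xy
    by (intro exI[of _ x] exI[of _ "[(x, y)]"] exI[of _ y] conjI arcs) simp_all
  ultimately show False using convex_path_le_max[OF F] r ne by fastforce
qed

section \<open>Size of the cross and the two bounds\<close>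

text \<open>The two arms share exactly the centre \<open>(x0, y0)\<close>, which accounts for the
  \<open>- 1\<close>.\<close>

lemma car_cross:
  assumes G: "pair_graph G" and H: "pair_graph H"
    and X: "corner G X x0 p" and Y: "corner H Y y0 q"
    and "hull_witness G X p \<or> q \<noteq> y0" "hull_witness H Y q \<or> p \<noteq> x0"
  shows "card X + card Y - 1 \<le> car (G \<box> H)"
proof -
  let ?S = "X \<times> {y0} \<union> {x0} \<times> Y"
  have fin: "finite X" "finite Y" and mem: "x0 \<in> X" "y0 \<in> Y"
    using X Y pair_graph_finite[OF G] pair_graph_finite[OF H] finite_subset
    unfolding corner_def by blast+
  have "?S = X \<times> {y0} \<union> {x0} \<times> (Y - {y0})" using mem by blast
  moreover have "card (X \<times> {y0} \<union> {x0} \<times> (Y - {y0})) = card (X \<times> {y0}) + card ({x0} \<times> (Y - {y0}))"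
    using fin by (intro card_Un_disjoint) auto
  moreover have "0 < card Y" using fin mem by (auto simp: card_gt_0_iff)
  ultimately have "card ?S = card X + card Y - 1"
    using mem by (simp add: card_cartesian_product)
  then show ?thesis
    using card_le_car[OF pair_graph_cartesian_product[OF G H] caratheodory_independent_cross[OF assms]]
    by simp
qed

theorem theorem5p4:
  fixes G :: "'a pair_pre_digraph" and H :: "'b pair_pre_digraph" and r s :: nat
  assumes "pair_graph G" and "pair_graph H"
    and "Digraph_Component.connected (with_proj G)"
    and "Digraph_Component.connected (with_proj H)"
    and "card (pverts G) \<ge> 2" and "card (pverts H) \<ge> 2"
    and "r = max_convex_induced_path G" and "s = max_convex_induced_path H"
  shows "car (G \<box> H) \<ge> max (r + s - 1) (car G + car H - 1)"
proof -
  note G = assms(1) and H = assms(2)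
  have neG: "pverts G \<noteq> {}" and neH: "pverts H \<noteq> {}" using assms(5,6) by auto
  have "car G + car H - 1 \<le> car (G \<box> H)"
  proof -
    obtain X x0 p where X: "corner G X x0 p" "hull_witness G X p" "card X = car G"
      using car_attained[OF G neG] .
    obtain Y y0 q where Y: "corner H Y y0 q" "hull_witness H Y q" "card Y = car H"
      using car_attained[OF H neH] .
    show ?thesis using car_cross[OF G H X(1) Y(1)] X Y by simp
  qed
  moreover have "r + s - 1 \<le> car (G \<box> H)"
  proof -
    obtain xs where "induced_path_list G xs" "length xs = r"
      using max_convex_induced_path_attained[OF G neG] assms(7) by blast
    then have r: "1 \<le> r" unfolding induced_path_list_def by (cases xs) auto
    obtain ys where "induced_path_list H ys" "length ys = s"
      using max_convex_induced_path_attained[OF H neH] assms(8) by blast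
    then have s: "1 \<le> s" unfolding induced_path_list_def by (cases ys) auto
    consider "2 \<le> r" "2 \<le> s" | "r < 2" | "s < 2" by linarith
    then show ?thesis
    proof cases
      case 1
      obtain X x0 p where X: "corner G X x0 p" "card X = r" "p \<noteq> x0"
        using corner_prefix_of_max_path[OF G neG r eq_refl[OF assms(7)]] 1(1) by metis
      obtain Y y0 q where Y: "corner H Y y0 q" "card Y = s" "q \<noteq> y0"
        using corner_prefix_of_max_path[OF H neH s eq_refl[OF assms(8)]] 1(2) by metis
      \<comment> \<open>Both paths have distinct ends, which settles both alternatives of
        \<open>car_cross\<close>.\<close>
      show ?thesis using car_cross[OF G H X(1) Y(1)] X Y by simp
    next
      case 2
      obtain x y where xy: "(x, y) \<in> parcs G" using connected_obtains_arc[OF G assms(3,5)] .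
      obtain z where z: "(x, z) \<in> parcs G" "(y, z) \<in> parcs G"
        using short_max_path_obtains_triangle[OF G xy] 2 assms(7) by blast
      have ne: "x \<noteq> y" "z \<noteq> x" using xy z pair_graph_irrefl[OF G] by auto
      \<comment> \<open>Here \<open>r = 1\<close>, so the target is \<open>s\<close>; an edge and a
        path on \<open>s - 1\<close> vertices suffice. The \<open>max\<close> keeps the path
        nonempty when \<open>s = 1\<close>.\<close>
      have "1 \<le> max 1 (s - 1)" "max 1 (s - 1) \<le> max_convex_induced_path H" using s assms(8) by auto
      then obtain Y y0 q where Y: "corner H Y y0 q" "card Y = max 1 (s - 1)"
        using corner_prefix_of_max_path[OF H neH] by metis
      \<comment> \<open>The triangle settles both alternatives: \<open>z\<close> is a witness for
        \<open>{x, y}\<close>, and \<open>z \<noteq> x\<close>. The ends of the path in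
        \<open>H\<close> may therefore coincide.\<close>
      have "card {x, y} + card Y - 1 \<le> car (G \<box> H)"
        using car_cross[OF G H corner_triangle(1)[OF G xy z] Y(1)] corner_triangle(2)[OF G xy z] ne
        by blast
      then show ?thesis using ne Y(2) 2 by simp
    next
      case 3
      obtain x y where xy: "(x, y) \<in> parcs H" using connected_obtains_arc[OF H assms(4,6)] .
      obtain z where z: "(x, z) \<in> parcs H" "(y, z) \<in> parcs H"
        using short_max_path_obtains_triangle[OF H xy] 3 assms(8) by blast
      have ne: "x \<noteq> y" "z \<noteq> x" using xy z pair_graph_irrefl[OF H] by auto
      have "1 \<le> max 1 (r - 1)" "max 1 (r - 1) \<le> max_convex_induced_path G" using r assms(7) by auto
      then obtain X x0 p where X: "corner G X x0 p" "card X = max 1 (r - 1)"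
        using corner_prefix_of_max_path[OF G neG] by metis
      have "card X + card {x, y} - 1 \<le> car (G \<box> H)"
        using car_cross[OF G H X(1) corner_triangle(1)[OF H xy z]] corner_triangle(2)[OF H xy z] ne
        by blast
      then show ?thesis using ne X(2) 3 by simp
    qed
  qed
  ultimately show ?thesis by simp
qed

end
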